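(* Let $I,J,M$ be finite sets and let $p:I\to M$ and $q:J\to M$ be surjective maps (category mappings). Let $\mathcal M\subseteq\Delta^{I\times_M J}$ be the Markov combination of the saturated models $\Delta^I$ and $\Delta^J$, that is, the set of all $(x_{ij})_{(i,j)\in I\times_M J}$ of the form $$x_{ij}=\lambda_{k,i}\,\mu_{k,j}\,h_k\qquad(k=p(i)=q(j)),$$ where $\lambda_{k,i}$ $(k\in M,\ i\in I_k)$, $\mu_{k,j}$ $(k\in M,\ j\in J_k)$ and $h_k$ $(k\in M)$ are non-negative reals with $\sum_{i\in I_k}\lambda_{k,i}=\sum_{j\in J_k}\mu_{k,j}=1$ for every $k\in M$ and $\sum_{k\in M}h_k=1$. For $x=(x_{ij})\in\Delta^{I\times_M J}$ let $$u_i=\sum_{j\in J}x_{ij}\ (i\in I),\qquad v_j=\sum_{i\in I}x_{ij}\ (j\in J),\qquad \hat x_{ij}=\frac{u_i\,v_j}{u_{M,k}\,\overline x}\quad\text{for }(i,j)\in I\times_M J,\ k=p(i)=q(j),$$ where $\overline x=\sum_{(i,j)\in I\times_M J}x_{ij}$. Then $\varphi:x\mapsto\hat x$ is a maximum likelihood estimator for $\mathcal M$.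
   Context: For a finite set $X$, $\Delta^X=\{v\in\mathbb R^X: v_x\ge0,\ \sum_x v_x=1\}$. For $k\in M$, $I_k=\{i\in I:p(i)=k\}$ and $J_k=\{j\in J:q(j)=k\}$. The mapping product is $I\times_M J=\{(i,j)\in I\times J:p(i)=q(j)\}$; vectors indexed by $I\times_M J$ are extended by zero to $I\times J$, so $x_{ij}=0$ whenever $p(i)\ne q(j)$. The aggregate is $u_{M,k}=\sum_{i\in I_k}u_i$. If $u_{M,k}=0$, then $\hat x_{ij}$ is interpreted as $0$ for $(i,j)\in I_k\times J_k$. A map $\varphi:\Delta^{I\times_M J}\to\mathcal M$ is a maximum likelihood estimator (MLE) for $\mathcal M$ if for every $x\in\Delta^{I\times_M J}$ (the empirical distribution of the data) the point $\varphi(x)$ belongs to $\mathcal M$ and maximizes the likelihood $y\mapsto\prod_{(i,j)\in I\times_M J}y_{ij}^{\,x_{ij}}$ over $y\in\mathcal M$, with the convention $0^0=1$. *)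

theory Defs
  imports Complex_Main
begin

text \<open>Vectors indexed by a finite set \<open>X\<close> are total functions that vanish outside \<open>X\<close>; in
  particular a vector on the mapping product is extended by zero.\<close>

definition simplex :: "'a set \<Rightarrow> ('a \<Rightarrow> real) set" where
  "simplex X = {v. (\<forall>x\<in>X. 0 \<le> v x) \<and> (\<forall>x. x \<notin> X \<longrightarrow> v x = 0) \<and> (\<Sum>x\<in>X. v x) = 1}"

definition fiber :: "('a \<Rightarrow> 'm) \<Rightarrow> 'a set \<Rightarrow> 'm \<Rightarrow> 'a set" where
  "fiber p I k = {i \<in> I. p i = k}"

definition mapping_product :: "('i \<Rightarrow> 'm) \<Rightarrow> ('j \<Rightarrow> 'm) \<Rightarrow> 'i set \<Rightarrow> 'j set \<Rightarrow> ('i \<times> 'j) set" where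
  "mapping_product p q I J = {(i, j). i \<in> I \<and> j \<in> J \<and> p i = q j}"

definition markov_combination ::
    "('i \<Rightarrow> 'm) \<Rightarrow> ('j \<Rightarrow> 'm) \<Rightarrow> 'i set \<Rightarrow> 'j set \<Rightarrow> 'm set \<Rightarrow> ('i \<times> 'j \<Rightarrow> real) set" where
  "markov_combination p q I J M =
    {x. \<exists>(lam :: 'm \<Rightarrow> 'i \<Rightarrow> real) (mu :: 'm \<Rightarrow> 'j \<Rightarrow> real) (h :: 'm \<Rightarrow> real).
        (\<forall>k\<in>M. (\<forall>i\<in>fiber p I k. 0 \<le> lam k i) \<and> (\<Sum>i\<in>fiber p I k. lam k i) = 1) \<and>
        (\<forall>k\<in>M. (\<forall>j\<in>fiber q J k. 0 \<le> mu k j) \<and> (\<Sum>j\<in>fiber q J k. mu k j) = 1) \<and>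
        (\<forall>k\<in>M. 0 \<le> h k) \<and> (\<Sum>k\<in>M. h k) = 1 \<and>
        x = (\<lambda>(i, j). if (i, j) \<in> mapping_product p q I J
                      then lam (p i) i * mu (p i) j * h (p i) else 0)}"

text \<open>Real powers with the convention \<open>0^0 = 1\<close>; note that \<open>0 powr 0 = 0\<close> in the library.\<close>

definition rpow :: "real \<Rightarrow> real \<Rightarrow> real" where
  "rpow y a = (if y = 0 \<and> a = 0 then 1 else y powr a)"

definition likelihood :: "'a set \<Rightarrow> ('a \<Rightarrow> real) \<Rightarrow> ('a \<Rightarrow> real) \<Rightarrow> real" where
  "likelihood X x y = (\<Prod>a\<in>X. rpow (y a) (x a))"

text \<open>Only the values of the estimator on the simplex matter.\<close>

definition is_MLE :: "'a set \<Rightarrow> ('a \<Rightarrow> real) set \<Rightarrow> (('a \<Rightarrow> real) \<Rightarrow> ('a \<Rightarrow> real)) \<Rightarrow> bool" where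
  "is_MLE X Model \<phi> \<longleftrightarrow>
    (\<forall>x\<in>simplex X. \<phi> x \<in> Model \<and> (\<forall>y\<in>Model. likelihood X x y \<le> likelihood X x (\<phi> x)))"

definition row_marginal :: "'j set \<Rightarrow> ('i \<times> 'j \<Rightarrow> real) \<Rightarrow> 'i \<Rightarrow> real" where
  "row_marginal J x i = (\<Sum>j\<in>J. x (i, j))"

definition col_marginal :: "'i set \<Rightarrow> ('i \<times> 'j \<Rightarrow> real) \<Rightarrow> 'j \<Rightarrow> real" where
  "col_marginal I x j = (\<Sum>i\<in>I. x (i, j))"

definition aggregate :: "('i \<Rightarrow> 'm) \<Rightarrow> 'i set \<Rightarrow> ('i \<Rightarrow> real) \<Rightarrow> 'm \<Rightarrow> real" where
  "aggregate p I u k = (\<Sum>i\<in>fiber p I k. u i)"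

definition x_hat ::
    "('i \<Rightarrow> 'm) \<Rightarrow> ('j \<Rightarrow> 'm) \<Rightarrow> 'i set \<Rightarrow> 'j set \<Rightarrow> ('i \<times> 'j \<Rightarrow> real) \<Rightarrow> ('i \<times> 'j \<Rightarrow> real)" where
  "x_hat p q I J x = (\<lambda>(i, j).
     let u = row_marginal J x; v = col_marginal I x; uM = aggregate p I u (p i);
         xbar = (\<Sum>a\<in>mapping_product p q I J. x a)
     in if (i, j) \<notin> mapping_product p q I J \<or> uM = 0 then 0
        else u i * v j / (uM * xbar))"

lemma mapping_product_Union:
  assumes "p ` I = M"
  shows "mapping_product p q I J = (\<Union>k\<in>M. fiber p I k \<times> fiber q J k)"
  using assms by (auto simp: mapping_product_def fiber_def)

lemma markov_combination_subset_simplex: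
  assumes fin: "finite I" "finite J" "finite M" and pI: "p ` I = M"
  shows "markov_combination p q I J M \<subseteq> simplex (mapping_product p q I J)"
proof
  fix x assume "x \<in> markov_combination p q I J M"
  then obtain lam mu h where
    l: "\<And>k. k \<in> M \<Longrightarrow> (\<forall>i\<in>fiber p I k. 0 \<le> lam k i) \<and> (\<Sum>i\<in>fiber p I k. lam k i) = 1" and
    m: "\<And>k. k \<in> M \<Longrightarrow> (\<forall>j\<in>fiber q J k. 0 \<le> mu k j) \<and> (\<Sum>j\<in>fiber q J k. mu k j) = 1" and
    h: "\<And>k. k \<in> M \<Longrightarrow> 0 \<le> h k" "(\<Sum>k\<in>M. h k) = 1" and
    x: "x = (\<lambda>(i, j). if (i, j) \<in> mapping_product p q I J
                      then lam (p i) i * mu (p i) j * h (p i) else 0)"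
    unfolding markov_combination_def by blast
  have nonneg: "\<forall>a\<in>mapping_product p q I J. 0 \<le> x a"
  proof
    fix a assume a: "a \<in> mapping_product p q I J"
    obtain i j where ij: "a = (i, j)" by (cases a)
    have k: "p i \<in> M" "i \<in> fiber p I (p i)" "j \<in> fiber q J (p i)"
      using a imageI[of i I p] by (auto simp: ij mapping_product_def fiber_def pI)
    have "0 \<le> lam (p i) i" "0 \<le> mu (p i) j" "0 \<le> h (p i)"
      using l[OF k(1)] m[OF k(1)] h(1)[OF k(1)] k(2,3) by auto
    then show "0 \<le> x a" by (simp add: x ij)
  qed
  have "(\<Sum>a\<in>mapping_product p q I J. x a) = (\<Sum>k\<in>M. \<Sum>a\<in>fiber p I k \<times> fiber q J k. x a)"
    unfolding mapping_product_Union[OF pI] using fin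
    by (intro sum.UNION_disjoint) (auto simp: fiber_def)
  also have "\<dots> = (\<Sum>k\<in>M. h k)"
  proof (rule sum.cong)
    fix k assume k: "k \<in> M"
    have "(\<Sum>a\<in>fiber p I k \<times> fiber q J k. x a)
        = (\<Sum>(i, j)\<in>fiber p I k \<times> fiber q J k. lam k i * mu k j * h k)"
      by (rule sum.cong) (auto simp: x mapping_product_def fiber_def)
    also have "\<dots> = (\<Sum>i\<in>fiber p I k. lam k i) * (\<Sum>j\<in>fiber q J k. mu k j) * h k"
      by (simp add: sum.cartesian_product[symmetric] sum_distrib_left sum_distrib_right)
         (rule sum.swap)
    finally show "(\<Sum>a\<in>fiber p I k \<times> fiber q J k. x a) = h k"
      using l[OF k] m[OF k] by simp
  qed simp
  finally show "x \<in> simplex (mapping_product p q I J)"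
    using nonneg h(2) by (auto simp: simplex_def x)
qed

end

theory Submission
  imports Defs
begin

text \<open>Writing a competitor as \<open>y = \<lambda> \<mu> h\<close> and the estimator as \<open>(u / u\<^sub>M) (v / u\<^sub>M) u\<^sub>M\<close>, the
  ratios \<open>a, b, c\<close> of the three factors satisfy \<open>a b c \<le> exp (a + b + c - 3)\<close>. Hence the likelihood
  ratio is at most the exponential of \<open>\<Sum> x (a + b + c - 3)\<close>, and each of \<open>\<Sum> x a\<close>, \<open>\<Sum> x b\<close>,
  \<open>\<Sum> x c\<close> is at most \<open>1\<close>, since the weights cancel against the marginals of \<open>x\<close>.\<close>

section \<open>Cellwise bounds on likelihood ratios\<close>

text \<open>At \<open>t = 0\<close> both sides are 1 by the convention on \<open>0^0\<close>. The
  factorization is therefore demanded only for \<open>0 < t\<close>, that is, on cells carrying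
  data; on other cells the ratio \<open>r\<close> may have a zero denominator.\<close>

lemma rpow_le_rpow_times_exp:
  assumes "0 < t \<Longrightarrow> z = w * r" "0 < t \<Longrightarrow> r \<le> exp s" "0 < t \<Longrightarrow> 0 \<le> r" "0 \<le> w" "0 \<le> t"
  shows "rpow z t \<le> rpow w t * exp (t * s)"
proof (cases "t = 0")
  case True
  then show ?thesis by (simp add: rpow_def)
next
  case False
  then have t: "0 < t" using assms(5) by simp
  have "r powr t \<le> exp s powr t"
    using assms(2,3)[OF t] t by (intro powr_mono2) auto
  also have "\<dots> = exp (t * s)"
    by (simp add: powr_def)
  finally have "w powr t * r powr t \<le> w powr t * exp (t * s)"
    by (intro mult_left_mono) auto
  then show ?thesis
    using False assms(1,3,4) t by (simp add: rpow_def powr_mult)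
qed

lemma rpow_nonneg: "0 \<le> rpow y t"
  by (simp add: rpow_def)

lemma likelihood_le_likelihood_times_exp:
  assumes "\<And>a. a \<in> X \<Longrightarrow> rpow (y a) (x a) \<le> rpow (z a) (x a) * exp (x a * s a)" "finite X"
  shows "likelihood X x y \<le> likelihood X x z * exp (\<Sum>a\<in>X. x a * s a)"
proof -
  have "likelihood X x y \<le> (\<Prod>a\<in>X. rpow (z a) (x a) * exp (x a * s a))"
    unfolding likelihood_def using assms(1) by (intro prod_mono) (auto simp: rpow_nonneg)
  then show ?thesis
    using assms(2) by (simp add: likelihood_def prod.distrib exp_sum)
qed

text \<open>Multiplies the tangent bound \<open>t \<le> exp (t - 1)\<close> over the three factors.
  It replaces the inequality for logarithms, so a factor 0 causes no special case.\<close>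

lemma triple_product_le_exp:
  fixes a b c :: real
  assumes "0 \<le> a" "0 \<le> b" "0 \<le> c"
  shows "a * b * c \<le> exp (a + b + c - 3)"
proof -
  have le: "t \<le> exp (t - 1)" for t :: real
    using exp_ge_add_one_self[of "t - 1"] by simp
  have "a * b * c \<le> exp (a - 1) * exp (b - 1) * exp (c - 1)"
    using assms by (intro mult_mono le) auto
  also have "\<dots> = exp (a + b + c - 3)"
    by (simp flip: exp_add add: algebra_simps)
  finally show ?thesis .
qed

section \<open>Normalization and summation over fibers\<close>

text \<open>The model demands weights of sum 1 even on a fiber of mass 0. There every
  \<open>u i\<close> vanishes, so any weights fit and the uniform ones are taken; otherwise
  \<open>u\<close> is divided by its sum.\<close>

lemma exists_normalized_weights:
  fixes u :: "'a \<Rightarrow> real"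
  assumes "finite A" "A \<noteq> {}" "\<And>i. i \<in> A \<Longrightarrow> 0 \<le> u i"
  shows "\<exists>w. (\<forall>i\<in>A. 0 \<le> w i) \<and> sum w A = 1 \<and> (\<forall>i\<in>A. u i = sum u A * w i)"
proof (cases "sum u A = 0")
  case True
  then have "\<forall>i\<in>A. u i = 0"
    using assms by (simp add: sum_nonneg_eq_0_iff)
  then show ?thesis
    using True assms(1,2) by (intro exI[of _ "\<lambda>i. 1 / card A"]) auto
next
  case False
  then show ?thesis
    using assms(3) by (intro exI[of _ "\<lambda>i. u i / sum u A"])
      (auto simp: sum_nonneg simp flip: sum_divide_distrib)
qed

lemma sum_fibers:
  fixes f :: "'a \<Rightarrow> real"
  assumes "finite I" "finite M" "p ` I = M"
  shows "(\<Sum>k\<in>M. \<Sum>i\<in>fiber p I k. f i) = (\<Sum>i\<in>I. f i)"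
  unfolding fiber_def using assms by (intro sum.group) auto

text \<open>Cancelling \<open>u i\<close> leaves weights of sum 1 on each fiber times the mass of
  that fiber. Where \<open>u i = 0\<close>, the left summand is 0, which is why only an inequality
  holds.\<close>

lemma sum_ratio_le_sum_aggregate:
  fixes u :: "'i \<Rightarrow> real"
  assumes "finite I" "finite M" "p ` I = M"
    and u: "\<And>i. i \<in> I \<Longrightarrow> 0 \<le> u i"
    and lam: "\<And>k i. k \<in> M \<Longrightarrow> i \<in> fiber p I k \<Longrightarrow> 0 \<le> lam k i"
      "\<And>k. k \<in> M \<Longrightarrow> (\<Sum>i\<in>fiber p I k. lam k i) = 1"
  shows "(\<Sum>i\<in>I. u i * (lam (p i) i * aggregate p I u (p i) / u i)) \<le> (\<Sum>i\<in>I. u i)"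
proof -
  have "(\<Sum>i\<in>I. u i * (lam (p i) i * aggregate p I u (p i) / u i))
      \<le> (\<Sum>i\<in>I. lam (p i) i * aggregate p I u (p i))"
  proof (rule sum_mono)
    fix i assume i: "i \<in> I"
    then have "0 \<le> lam (p i) i"
      using assms(3) by (intro lam(1)) (auto simp: fiber_def)
    moreover have "0 \<le> aggregate p I u (p i)"
      unfolding aggregate_def using u by (intro sum_nonneg) (auto simp: fiber_def)
    ultimately show "u i * (lam (p i) i * aggregate p I u (p i) / u i)
        \<le> lam (p i) i * aggregate p I u (p i)"
      by (cases "u i = 0") auto
  qed
  also have "\<dots> = (\<Sum>k\<in>M. \<Sum>i\<in>fiber p I k. lam (p i) i * aggregate p I u (p i))"
    using assms(1-3) by (rule sum_fibers[symmetric])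
  also have "\<dots> = (\<Sum>k\<in>M. \<Sum>i\<in>fiber p I k. lam k i * aggregate p I u k)"
    by (intro sum.cong) (auto simp: fiber_def)
  also have "\<dots> = (\<Sum>k\<in>M. aggregate p I u k)"
    by (simp add: lam(2) flip: sum_distrib_right)
  also have "\<dots> = (\<Sum>i\<in>I. u i)"
    unfolding aggregate_def using assms(1-3) by (rule sum_fibers)
  finally show ?thesis .
qed

section \<open>Marginals of fixed data\<close>

context
  fixes I :: "'i set" and J :: "'j set" and M :: "'m set"
    and p :: "'i \<Rightarrow> 'm" and q :: "'j \<Rightarrow> 'm" and x :: "'i \<times> 'j \<Rightarrow> real"
  assumes fin: "finite I" "finite J" "finite M"
    and pI: "p ` I = M" and qJ: "q ` J = M"
    and x: "x \<in> simplex (mapping_product p q I J)"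
begin

private abbreviation (input) "X \<equiv> mapping_product p q I J"
private abbreviation (input) "u \<equiv> row_marginal J x"
private abbreviation (input) "v \<equiv> col_marginal I x"
private abbreviation (input) "uM \<equiv> aggregate p I u"

private lemma X_subset: "X \<subseteq> I \<times> J"
  by (auto simp: mapping_product_def)

private lemma finite_X: "finite X"
  using X_subset fin finite_subset by blast

private lemma x_nonneg: "0 \<le> x a"
  using x by (cases a; cases "a \<in> X") (auto simp: simplex_def)

private lemma x_eq_0: "a \<notin> X \<Longrightarrow> x a = 0"
  using x by (cases a) (auto simp: simplex_def)

private lemma sum_x: "(\<Sum>a\<in>X. x a) = 1"
  using x by (auto simp: simplex_def)

text \<open>Extension by zero makes the index set a full rectangle, so an \<open>f\<close> depending
  on one coordinate only is summed against a marginal.\<close>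

private lemma sum_X_eq: "(\<Sum>(i, j)\<in>X. x (i, j) * f i j) = (\<Sum>i\<in>I. \<Sum>j\<in>J. x (i, j) * f i j)"
  unfolding sum.cartesian_product
  using fin X_subset x_eq_0 by (intro sum.mono_neutral_left) auto

private lemma sum_X_row: "(\<Sum>(i, j)\<in>X. x (i, j) * f i) = (\<Sum>i\<in>I. u i * f i)"
  by (simp add: sum_X_eq row_marginal_def sum_distrib_right)

private lemma sum_X_col: "(\<Sum>(i, j)\<in>X. x (i, j) * f j) = (\<Sum>j\<in>J. v j * f j)"
  unfolding sum_X_eq by (subst sum.swap) (simp add: col_marginal_def sum_distrib_right)

private lemma sum_u: "(\<Sum>i\<in>I. u i) = 1"
  using sum_X_row[of "\<lambda>_. 1"] sum_x by (simp add: case_prod_unfold)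

private lemma sum_v: "(\<Sum>j\<in>J. v j) = 1"
  using sum_X_col[of "\<lambda>_. 1"] sum_x by (simp add: case_prod_unfold)

private lemma u_nonneg: "0 \<le> u i"
  by (simp add: row_marginal_def sum_nonneg x_nonneg)

private lemma v_nonneg: "0 \<le> v j"
  by (simp add: col_marginal_def sum_nonneg x_nonneg)

private lemma uM_nonneg: "0 \<le> uM k"
  by (simp add: aggregate_def sum_nonneg u_nonneg)

text \<open>Both sides are the mass of \<open>x\<close> on the block of \<open>k\<close>, because
  \<open>x\<close> vanishes where \<open>p i \<noteq> q j\<close>. Hence \<open>uM\<close>
  normalizes rows and columns alike.\<close>

private lemma aggregate_col_eq: "aggregate q J v k = uM k"
proof -
  have "uM k = (\<Sum>i\<in>fiber p I k. \<Sum>j\<in>fiber q J k. x (i, j))"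
    unfolding aggregate_def row_marginal_def using fin
    by (intro sum.cong sum.mono_neutral_right)
      (auto simp: fiber_def mapping_product_def intro!: x_eq_0)
  also have "\<dots> = (\<Sum>j\<in>fiber q J k. \<Sum>i\<in>fiber p I k. x (i, j))"
    by (rule sum.swap)
  also have "\<dots> = aggregate q J v k"
    unfolding aggregate_def col_marginal_def using fin
    by (intro sum.cong sum.mono_neutral_left)
      (auto simp: fiber_def mapping_product_def intro!: x_eq_0)
  finally show ?thesis ..
qed

private lemma sum_uM: "(\<Sum>k\<in>M. uM k) = 1"
  unfolding aggregate_def using sum_fibers[OF fin(1,3) pI] sum_u by simp

text \<open>The data have total mass 1, and the default value 0 of division by zero absorbs the case
  \<open>uM (p i) = 0\<close>.\<close>

private lemma x_hat_eq:
  "x_hat p q I J x (i, j) = (if (i, j) \<in> X then u i * v j / uM (p i) else 0)"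
  by (simp add: x_hat_def Let_def sum_x)

section \<open>The estimator: membership and optimality\<close>

lemma x_hat_in_markov_combination: "x_hat p q I J x \<in> markov_combination p q I J M"
proof -
  have "\<forall>k\<in>M. \<exists>w. (\<forall>i\<in>fiber p I k. 0 \<le> w i) \<and> sum w (fiber p I k) = 1 \<and>
      (\<forall>i\<in>fiber p I k. u i = sum u (fiber p I k) * w i)"
    using fin pI u_nonneg by (intro ballI exists_normalized_weights) (auto simp: fiber_def)
  then obtain lam where lam: "\<forall>k\<in>M. (\<forall>i\<in>fiber p I k. 0 \<le> lam k i) \<and>
      sum (lam k) (fiber p I k) = 1 \<and> (\<forall>i\<in>fiber p I k. u i = uM k * lam k i)"
    unfolding aggregate_def by metis
  have "\<forall>k\<in>M. \<exists>w. (\<forall>j\<in>fiber q J k. 0 \<le> w j) \<and> sum w (fiber q J k) = 1 \<and>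
      (\<forall>j\<in>fiber q J k. v j = sum v (fiber q J k) * w j)"
    using fin qJ v_nonneg by (intro ballI exists_normalized_weights) (auto simp: fiber_def)
  then obtain mu where mu: "\<forall>k\<in>M. (\<forall>j\<in>fiber q J k. 0 \<le> mu k j) \<and>
      sum (mu k) (fiber q J k) = 1 \<and> (\<forall>j\<in>fiber q J k. v j = uM k * mu k j)"
    unfolding aggregate_col_eq[symmetric] unfolding aggregate_def by metis
  have "x_hat p q I J x (i, j) =
      (if (i, j) \<in> X then lam (p i) i * mu (p i) j * uM (p i) else 0)" for i j
  proof (cases "(i, j) \<in> X")
    case True
    then have "p i \<in> M" "i \<in> fiber p I (p i)" "j \<in> fiber q J (p i)"
      using imageI[of i I p] pI by (auto simp: mapping_product_def fiber_def)
    then have "u i = uM (p i) * lam (p i) i" "v j = uM (p i) * mu (p i) j"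
      using lam mu by auto
    \<comment> \<open>One of the two factors \<open>uM (p i)\<close> cancels; if it is 0, both sides
      are 0.\<close>
    then show ?thesis
      using True by (simp only: x_hat_eq) simp
  qed (simp add: x_hat_eq)
  then have "x_hat p q I J x = (\<lambda>(i, j). if (i, j) \<in> X
      then lam (p i) i * mu (p i) j * uM (p i) else 0)"
    by auto
  then show ?thesis
    unfolding markov_combination_def using lam mu uM_nonneg sum_uM by blast
qed

lemma likelihood_le_x_hat:
  assumes "y \<in> markov_combination p q I J M"
  shows "likelihood X x y \<le> likelihood X x (x_hat p q I J x)"
proof -
  obtain lam mu h where
    lam: "\<And>k i. k \<in> M \<Longrightarrow> i \<in> fiber p I k \<Longrightarrow> 0 \<le> lam k i"
      "\<And>k. k \<in> M \<Longrightarrow> (\<Sum>i\<in>fiber p I k. lam k i) = 1" and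
    mu: "\<And>k j. k \<in> M \<Longrightarrow> j \<in> fiber q J k \<Longrightarrow> 0 \<le> mu k j"
      "\<And>k. k \<in> M \<Longrightarrow> (\<Sum>j\<in>fiber q J k. mu k j) = 1" and
    h: "\<And>k. k \<in> M \<Longrightarrow> 0 \<le> h k" "(\<Sum>k\<in>M. h k) = 1" and
    y: "y = (\<lambda>(i, j). if (i, j) \<in> X then lam (p i) i * mu (p i) j * h (p i) else 0)"
    using assms unfolding markov_combination_def by blast
  \<comment> \<open>The three ratios of the factors of \<open>y\<close> to those of the estimator.
    Writing \<open>q j\<close> for the block makes \<open>b\<close> a function of \<open>j\<close>
    alone, ready for the column marginal.\<close>
  define a where "a i = lam (p i) i * uM (p i) / u i" for i
  define b where "b j = mu (q j) j * uM (q j) / v j" for j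
  define c where "c k = h k / uM k" for k
  define s where "s = (\<lambda>(i, j). a i + b j + c (p i) - 3)"
  have "likelihood X x y \<le> likelihood X x (x_hat p q I J x) * exp (\<Sum>e\<in>X. x e * s e)"
  proof (rule likelihood_le_likelihood_times_exp)
    fix e assume e: "e \<in> X"
    obtain i j where ij: "e = (i, j)" by (cases e)
    have mem: "i \<in> I" "j \<in> J" "q j = p i" "p i \<in> M" "i \<in> fiber p I (p i)" "j \<in> fiber q J (p i)"
      using e imageI[of i I p] pI by (auto simp: ij mapping_product_def fiber_def)
    have nn: "0 \<le> a i" "0 \<le> b j" "0 \<le> c (p i)"
      using lam(1) mu(1) h(1) mem uM_nonneg u_nonneg v_nonneg
      by (auto simp: a_def b_def c_def)
    show "rpow (y e) (x e) \<le> rpow (x_hat p q I J x e) (x e) * exp (x e * s e)"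
    proof (rule rpow_le_rpow_times_exp[where r = "a i * b j * c (p i)"])
      assume pos: "0 < x e"
      \<comment> \<open>A cell with data has positive marginals and a positive block mass, so all
        denominators in \<open>a\<close>, \<open>b\<close>, \<open>c\<close> and in the estimator
        are nonzero.\<close>
      have "x e \<le> u i"
        unfolding ij row_marginal_def using fin mem x_nonneg
        by (intro member_le_sum[of j J "\<lambda>j. x (i, j)"]) auto
      moreover have "x e \<le> v j"
        unfolding ij col_marginal_def using fin mem x_nonneg
        by (intro member_le_sum[of i I "\<lambda>i. x (i, j)"]) auto
      moreover have "u i \<le> uM (p i)"
        unfolding aggregate_def using fin mem u_nonneg
        by (intro member_le_sum) (auto simp: fiber_def)
      ultimately have "u i \<noteq> 0" "v j \<noteq> 0" "uM (p i) \<noteq> 0"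
        using pos by auto
      then show "y e = x_hat p q I J x e * (a i * b j * c (p i))"
        using e mem by (simp add: y ij x_hat_eq a_def b_def c_def)
    qed (use nn in \<open>auto simp: s_def ij x_hat_eq u_nonneg v_nonneg uM_nonneg x_nonneg
          intro!: triple_product_le_exp\<close>)
  qed (rule finite_X)
  also have "\<dots> \<le> likelihood X x (x_hat p q I J x) * 1"
  proof (rule mult_left_mono)
    have A: "(\<Sum>i\<in>I. u i * a i) \<le> 1"
      unfolding a_def
      using sum_ratio_le_sum_aggregate[where u = u and lam = lam, OF fin(1,3) pI u_nonneg lam] sum_u
      by simp
    have B: "(\<Sum>j\<in>J. v j * b j) \<le> 1"
      unfolding b_def
      using sum_ratio_le_sum_aggregate[where u = v and lam = mu, OF fin(2,3) qJ v_nonneg mu] sum_v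
      by (simp add: aggregate_col_eq)
    have "(\<Sum>i\<in>I. u i * c (p i)) = (\<Sum>k\<in>M. \<Sum>i\<in>fiber p I k. u i * c (p i))"
      using sum_fibers[OF fin(1,3) pI] by simp
    also have "\<dots> = (\<Sum>k\<in>M. uM k * c k)"
      unfolding aggregate_def sum_distrib_right by (intro sum.cong) (auto simp: fiber_def)
    \<comment> \<open>A block with \<open>uM k = 0\<close> contributes 0 on the left; on the others
      \<open>uM k\<close> cancels.\<close>
    also have "\<dots> \<le> (\<Sum>k\<in>M. h k)"
      using h(1) by (intro sum_mono) (auto simp: c_def)
    finally have C: "(\<Sum>i\<in>I. u i * c (p i)) \<le> 1"
      using h(2) by simp
    \<comment> \<open>The first three sums reduce to the marginal sums bounded by 1 in
      \<open>A\<close>, \<open>B\<close>, \<open>C\<close>; the last term is exactly 3.\<close>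
    have "(\<Sum>e\<in>X. x e * s e) = (\<Sum>(i, j)\<in>X. x (i, j) * a i) + (\<Sum>(i, j)\<in>X. x (i, j) * b j)
        + (\<Sum>(i, j)\<in>X. x (i, j) * c (p i)) - 3 * (\<Sum>e\<in>X. x e)"
      unfolding sum_distrib_left sum.distrib[symmetric] sum_subtractf[symmetric]
      by (intro sum.cong) (auto simp: s_def algebra_simps)
    also have "\<dots> \<le> 0"
      using A B C by (simp add: sum_X_row sum_X_row[of "\<lambda>i. c (p i)"] sum_X_col sum_x)
    finally show "exp (\<Sum>e\<in>X. x e * s e) \<le> 1"
      by simp
  qed (simp add: likelihood_def prod_nonneg rpow_nonneg)
  finally show ?thesis by simp
qed

end

theorem theorem35:
  fixes I :: "'i set" and J :: "'j set" and M :: "'m set"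
    and p :: "'i \<Rightarrow> 'm" and q :: "'j \<Rightarrow> 'm"
  assumes "finite I" and "finite J" and "finite M"
    and "p ` I = M" and "q ` J = M"
  shows "is_MLE (mapping_product p q I J) (markov_combination p q I J M) (x_hat p q I J)"
  unfolding is_MLE_def
  using x_hat_in_markov_combination[OF assms] likelihood_le_x_hat[OF assms] by blast

end
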